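(* Let $\mathbb{T}$ be a time scale, let $a,b\in\mathbb{T}$ with $a<b$, let $f:[a,b]\to\mathbb{R}$ be differentiable, and put $M=\sup_{a<x<b}|f^\Delta(x)|$. Suppose that $\alpha_1=\frac{5a+b}{6}\in\mathbb{T}$, $\alpha_2=\frac{a+5b}{6}\in\mathbb{T}$, and $x\in\left[\frac{5a+b}{6},\frac{a+5b}{6}\right]\cap\mathbb{T}$. Then we have the sharp inequality on time scales $$\left|\int_a^b f^\sigma(t)\,\Delta t-\frac{b-a}{3}\left(\frac{f(a)+f(b)}{2}+2f(x)\right)\right|\le M\left(h_2\left(a,\tfrac{5a+b}{6}\right)+h_2\left(x,\tfrac{5a+b}{6}\right)+h_2\left(x,\tfrac{a+5b}{6}\right)+h_2\left(b,\tfrac{a+5b}{6}\right)\right).$$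
   Context: A time scale $\mathbb{T}$ is an arbitrary nonempty closed subset of $\mathbb{R}$. An interval means the intersection of the real interval with $\mathbb{T}$. The forward jump operator is $\sigma(t)=\inf\{s\in\mathbb{T}:s>t\}$ (with $\sigma(t)=t$ if $t=\max\mathbb{T}$), and $f^\sigma(t)=f(\sigma(t))$. If $\mathbb{T}$ has a left-scattered maximum $m$ (i.e. $\sup\{s\in\mathbb{T}:s<m\}<m$), then $\mathbb{T}^\kappa=\mathbb{T}\setminus\{m\}$; otherwise $\mathbb{T}^\kappa=\mathbb{T}$. For $t\in\mathbb{T}^\kappa$, $f^\Delta(t)$ is the number, if it exists, such that for every $\varepsilon>0$ there is a neighborhood $U$ of $t$ in $\mathbb{T}$ with $|f(\sigma(t))-f(s)-f^\Delta(t)(\sigma(t)-s)|\le\varepsilon|\sigma(t)-s|$ for all $s\in U$. Differentiable means $\Delta$-differentiable, i.e. $f^\Delta(t)$ exists for all $t\in\mathbb{T}^\kappa$; for a function on $[a,b]$ this is read with the time scale $[a,b]\cap\mathbb{T}$ in place of $\mathbb{T}$. $F$ is a $\Delta$-antiderivative of $g$ if $F^\Delta=g$ on $\mathbb{T}^\kappa$ (with the same reading for functions on $[a,b]$), and then $\int_c^d g(t)\,\Delta t=F(d)-F(c)$. Define $h_0(t,s)=1$ and $h_{k+1}(t,s)=\int_s^t h_k(\tau,s)\,\Delta\tau$ for $s,t\in\mathbb{T}$; thus $h_2(t,s)=\int_s^t(\tau-s)\,\Delta\tau$. "Sharp" is used in the sense that the right-hand side of the inequality cannot be replaced by a smaller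 one.
   Formalization: When a is right-scattered, M is taken as the supremum of |f^Δ| over a ≤ x < b instead of a < x < b; otherwise the inequality fails (f(a)=1 and f=0 elsewhere gives M=0 but left-hand side (b-a)/6 > 0). *)

theory Defs
  imports "HOL-Analysis.Analysis"
begin

definition time_scale :: "real set \<Rightarrow> bool" where
  "time_scale T \<longleftrightarrow> closed T \<and> T \<noteq> {}"

definition forward_jump :: "real set \<Rightarrow> real \<Rightarrow> real" where
  "forward_jump T t = (if \<exists>s\<in>T. t < s then Inf {s \<in> T. t < s} else t)"

(* The nonemptiness conjunct encodes the usual convention sup {} = inf T:
   the point of a one-point time scale is not left-scattered. *)
definition left_scattered_max :: "real set \<Rightarrow> real \<Rightarrow> bool" where
  "left_scattered_max T m \<longleftrightarrow>
     m \<in> T \<and> (\<forall>s\<in>T. s \<le> m) \<and> {s \<in> T. s < m} \<noteq> {} \<and> Sup {s \<in> T. s < m} < m"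

definition ts_kappa :: "real set \<Rightarrow> real set" where
  "ts_kappa T = {t \<in> T. \<not> left_scattered_max T t}"

(* Functions on a time scale are total functions on the reals; every notion below
   only looks at their values on T. *)
definition has_delta_deriv :: "real set \<Rightarrow> (real \<Rightarrow> real) \<Rightarrow> real \<Rightarrow> real \<Rightarrow> bool" where
  "has_delta_deriv T f t D \<longleftrightarrow>
     (\<forall>\<epsilon>>0. \<exists>U. open U \<and> t \<in> U \<and>
        (\<forall>s \<in> U \<inter> T. \<bar>f (forward_jump T t) - f s - D * (forward_jump T t - s)\<bar>
                         \<le> \<epsilon> * \<bar>forward_jump T t - s\<bar>))"

definition delta_differentiable :: "real set \<Rightarrow> (real \<Rightarrow> real) \<Rightarrow> bool" where
  "delta_differentiable T f \<longleftrightarrow> (\<forall>t \<in> ts_kappa T. \<exists>D. has_delta_deriv T f t D)"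

(* Only meaningful for t in ts_kappa T, where the derivative is unique if it exists. *)
definition delta_deriv :: "real set \<Rightarrow> (real \<Rightarrow> real) \<Rightarrow> real \<Rightarrow> real" where
  "delta_deriv T f t = (THE D. has_delta_deriv T f t D)"

definition delta_antiderivative :: "real set \<Rightarrow> (real \<Rightarrow> real) \<Rightarrow> (real \<Rightarrow> real) \<Rightarrow> bool" where
  "delta_antiderivative T g F \<longleftrightarrow> (\<forall>t \<in> ts_kappa T. has_delta_deriv T F t (g t))"

definition delta_integral :: "real set \<Rightarrow> real \<Rightarrow> real \<Rightarrow> (real \<Rightarrow> real) \<Rightarrow> real" where
  "delta_integral T c d g = (THE I. \<exists>F. delta_antiderivative T g F \<and> I = F d - F c)"

primrec ts_monomial :: "real set \<Rightarrow> nat \<Rightarrow> real \<Rightarrow> real \<Rightarrow> real" where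
  "ts_monomial T 0 t s = 1"
| "ts_monomial T (Suc k) t s = delta_integral T s t (\<lambda>\<tau>. ts_monomial T k \<tau> s)"

(* The supremum of |f^Delta| over the points of S strictly between a and b, to which a is
   added exactly when it is right-scattered. In that case f^Delta(a) is not controlled by
   the derivative at the other points: the function that is 1 at a and 0 on the rest of S
   has derivative 0 at every point strictly between a and b.
   The value is infinite if the derivative is unbounded. *)
definition sup_delta_deriv :: "real set \<Rightarrow> real \<Rightarrow> real \<Rightarrow> (real \<Rightarrow> real) \<Rightarrow> ereal" where
  "sup_delta_deriv S a b f =
     (SUP t \<in> (S \<inter> {a<..<b}) \<union> (if a < forward_jump S a then {a} else {}).
        ereal \<bar>delta_deriv S f t\<bar>)"

end

theory Submission
  imports Defs
begin

text \<open>
  With \<open>\<alpha> = (5a + b)/6\<close> and \<open>\<beta> = (a + 5b)/6\<close>, integration by parts against the kernel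
  \<open>p(t) = t - \<alpha>\<close> on \<open>[a, x)\<close>, \<open>p(t) = t - \<beta>\<close> on \<open>[x, b)\<close> gives the Montgomery identity
  \<open>\<integral> f\<^sup>\<sigma> \<Delta>t - (b - a)/3 ((f(a) + f(b))/2 + 2 f(x)) = - \<integral> p f\<^sup>\<Delta> \<Delta>t\<close>,
  and the right-hand side of the inequality is \<open>M \<integral> |p| \<Delta>t\<close>. Since \<open>f\<^sup>\<Delta>\<close> need not be integrable,
  increments of \<open>(t - \<alpha>) f - \<integral> f\<^sup>\<sigma>\<close>, an antiderivative of \<open>(t - \<alpha>) f\<^sup>\<Delta>\<close>, are estimated by the
  mean value inequality instead, on each interval where \<open>p\<close> has constant sign. The inequality is
  sharp because \<open>f\<^sup>\<Delta>\<close> may be a continuous function close to \<open>m sgn p\<close>.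
\<close>

section \<open>The forward jump operator\<close>

lemma forward_jump_ge: "t \<le> forward_jump T t"
  unfolding forward_jump_def by (auto intro!: cInf_greatest)

lemma forward_jump_le: "u \<in> T \<Longrightarrow> t < u \<Longrightarrow> forward_jump T t \<le> u"
  unfolding forward_jump_def by (auto intro!: cInf_lower bdd_belowI[of _ t])

lemma forward_jump_in:
  assumes "closed T" "t \<in> T"
  shows "forward_jump T t \<in> T"
proof (cases "\<exists>s\<in>T. t < s")
  case True
  then have "Inf {s \<in> T. t < s} \<in> closure {s \<in> T. t < s}"
    by (intro closure_contains_Inf) (auto intro!: bdd_belowI[of _ t])
  also have "\<dots> \<subseteq> T"
    using assms(1) by (intro closure_minimal) auto
  finally show ?thesis using True by (simp add: forward_jump_def)
qed (use assms in \<open>auto simp: forward_jump_def\<close>)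

lemma right_dense_approx:
  assumes "forward_jump T t = t" "u \<in> T" "t < u" "d > 0"
  obtains s where "s \<in> T" "t < s" "s < t + d"
proof -
  have "\<exists>s\<in>T. t < s" using assms by blast
  then have "Inf {s \<in> T. t < s} = t" using assms(1) by (auto simp: forward_jump_def)
  moreover have "{s \<in> T. t < s} \<noteq> {}" using assms by blast
  ultimately obtain s where "s \<in> {s \<in> T. t < s}" "s < t + d"
    using assms(4) cInf_lessD[of "{s \<in> T. t < s}" "t + d"] by auto
  then show thesis using that by auto
qed

section \<open>The delta derivative: continuity, uniqueness, rules of calculation\<close>

lemma has_delta_deriv_iff_eventually:
  "has_delta_deriv T f t D \<longleftrightarrow>
     (\<forall>e>0. \<forall>\<^sub>F s in nhds t. s \<in> T \<longrightarrow>
        \<bar>f (forward_jump T t) - f s - D * (forward_jump T t - s)\<bar> \<le> e * \<bar>forward_jump T t - s\<bar>)"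
  unfolding has_delta_deriv_def eventually_nhds Ball_def Int_iff imp_conjL by (rule refl)

text \<open>The point \<open>t\<close> lies in each of its neighborhoods, so the defining estimate
  may be read at s = t for every \<epsilon>. At a right-scattered point the derivative is thus the
  slope across the gap.\<close>

lemma has_delta_deriv_jump:
  assumes "has_delta_deriv T f t D" "t \<in> T"
  shows "f (forward_jump T t) - f t = D * (forward_jump T t - t)"
proof -
  let ?\<sigma> = "forward_jump T t"
  have le: "\<bar>f ?\<sigma> - f t - D * (?\<sigma> - t)\<bar> \<le> e * \<bar>?\<sigma> - t\<bar>" if "e > 0" for e
    using assms(1)[unfolded has_delta_deriv_def, rule_format, OF that] assms(2) by blast
  have "\<bar>f ?\<sigma> - f t - D * (?\<sigma> - t)\<bar> \<le> 0"
  proof (rule field_le_epsilon)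
    fix e :: real assume "e > 0"
    then have "\<bar>f ?\<sigma> - f t - D * (?\<sigma> - t)\<bar> \<le> e / (\<bar>?\<sigma> - t\<bar> + 1) * \<bar>?\<sigma> - t\<bar>"
      by (intro le) (auto intro: divide_pos_pos)
    also have "\<dots> \<le> e"
      using \<open>e > 0\<close> by (simp add: field_simps)
    finally show "\<bar>f ?\<sigma> - f t - D * (?\<sigma> - t)\<bar> \<le> 0 + e" by simp
  qed
  then show ?thesis by simp
qed

lemma has_delta_deriv_continuous:
  assumes f: "has_delta_deriv T f t D" and t: "t \<in> T"
  shows "continuous (at t within T) f"
proof -
  let ?\<sigma> = "forward_jump T t"
  have J: "f ?\<sigma> - f t = D * (?\<sigma> - t)" by (rule has_delta_deriv_jump[OF f t])
  have "\<exists>d>0. \<forall>s\<in>T. \<bar>s - t\<bar> < d \<longrightarrow> \<bar>f s - f t\<bar> < e" if "e > 0" for e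
  proof -
    \<comment> \<open>At a right-scattered point the distance from \<sigma> to \<open>s\<close> does
      not shrink as \<open>s\<close> tends to \<open>t\<close>. So \<open>k\<close> is chosen
      against \<open>N\<close>, which bounds this distance whenever |s - t| < 1.\<close>
    define N where "N = \<bar>?\<sigma> - t\<bar> + 1"
    have N: "N > 0" by (simp add: N_def add_nonneg_pos)
    define k where "k = e / (2 * N)"
    have k: "k > 0" unfolding k_def using that N by simp
    have "\<forall>\<^sub>F s in nhds t. s \<in> T \<longrightarrow> \<bar>f ?\<sigma> - f s - D * (?\<sigma> - s)\<bar> \<le> k * \<bar>?\<sigma> - s\<bar>"
      using f k by (auto simp: has_delta_deriv_iff_eventually)
    then obtain d where d: "d > 0"
      "\<And>s. dist s t < d \<Longrightarrow> s \<in> T \<Longrightarrow> \<bar>f ?\<sigma> - f s - D * (?\<sigma> - s)\<bar> \<le> k * \<bar>?\<sigma> - s\<bar>"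
      by (auto simp: eventually_nhds_metric)
    define d' where "d' = min d (min 1 (e / (2 * (\<bar>D\<bar> + 1))))"
    have d': "d' > 0" using d that by (auto simp: d'_def intro: divide_pos_pos)
    have "\<bar>f s - f t\<bar> < e" if s: "s \<in> T" "\<bar>s - t\<bar> < d'" for s
    proof -
      have "f s - f t = D * (s - t) - (f ?\<sigma> - f s - D * (?\<sigma> - s))"
        using J by (simp add: algebra_simps)
      then have "\<bar>f s - f t\<bar> \<le> \<bar>D\<bar> * \<bar>s - t\<bar> + k * \<bar>?\<sigma> - s\<bar>"
        using d(2)[of s] s by (auto simp: d'_def dist_real_def abs_mult[symmetric])
      also have "k * \<bar>?\<sigma> - s\<bar> \<le> k * N"
        using s k by (intro mult_left_mono) (auto simp: d'_def N_def)
      also have "\<dots> = e / 2"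
        using N by (simp add: k_def)
      also have "\<bar>D\<bar> * \<bar>s - t\<bar> < e / 2"
      proof -
        have "\<bar>D\<bar> * \<bar>s - t\<bar> \<le> \<bar>D\<bar> * (e / (2 * (\<bar>D\<bar> + 1)))"
          using s by (intro mult_left_mono) (auto simp: d'_def)
        also have "\<dots> < e / 2"
          using \<open>e > 0\<close> by (simp add: field_simps)
        finally show ?thesis .
      qed
      finally show ?thesis by simp
    qed
    then show ?thesis using d' by blast
  qed
  then show ?thesis
    by (auto simp: continuous_within_eps_delta dist_real_def)
qed

text \<open>The only point at which no derivative is assumed is a left-scattered maximum. It is
  isolated in \<open>T\<close>, so continuity there is automatic.\<close>

lemma continuous_on_of_delta_deriv:
  assumes "\<And>t. t \<in> ts_kappa T \<Longrightarrow> \<exists>D. has_delta_deriv T f t D"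
  shows "continuous_on T f"
  unfolding continuous_on_eq_continuous_within
proof
  fix t assume t: "t \<in> T"
  show "continuous (at t within T) f"
  proof (cases "left_scattered_max T t")
    case True
    then have lt: "Sup {s \<in> T. s < t} < t" by (simp add: left_scattered_max_def)
    have "{Sup {s \<in> T. s < t}<..} \<inter> T \<subseteq> {t}"
    proof (clarsimp)
      fix s assume s: "s \<in> T" "Sup {s \<in> T. s < t} < s"
      show "s = t"
      proof (rule ccontr)
        assume "s \<noteq> t"
        moreover have "s \<le> t" using True s by (auto simp: left_scattered_max_def)
        ultimately have "s \<le> Sup {s \<in> T. s < t}"
          using s by (intro cSup_upper) (auto intro!: bdd_aboveI[of _ t])
        then show False using s by simp
      qed
    qed
    then have "\<not> t islimpt T"
      unfolding islimpt_def using lt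
      by (auto intro!: exI[of _ "{Sup {s \<in> T. s < t}<..}"])
    then have "at t within T = bot" by (simp add: trivial_limit_within)
    then show ?thesis by simp
  next
    case False
    then show ?thesis using assms[of t] t has_delta_deriv_continuous
      by (auto simp: ts_kappa_def)
  qed
qed

lemma in_ts_kappa: "t \<in> T \<Longrightarrow> u \<in> T \<Longrightarrow> t < u \<Longrightarrow> t \<in> ts_kappa T"
  by (force simp: ts_kappa_def left_scattered_max_def)

text \<open>At a right-scattered point the slope across the gap determines the derivative. At a
  right-dense point that is not the maximum, points s > t accumulate, and the two estimates at one
  of them bound the difference of the derivatives by two thirds of itself.\<close>

lemma has_delta_deriv_unique:
  assumes "has_delta_deriv T f t D" "has_delta_deriv T f t D'" "t \<in> T" "u \<in> T" "t < u"
  shows "D = D'"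
proof (cases "forward_jump T t = t")
  case False
  then show ?thesis using has_delta_deriv_jump[OF assms(1,3)] has_delta_deriv_jump[OF assms(2,3)]
    by auto
next
  case True
  show ?thesis
  proof (rule ccontr)
    assume "D \<noteq> D'"
    define e where "e = \<bar>D - D'\<bar> / 3"
    have e: "e > 0" using \<open>D \<noteq> D'\<close> by (simp add: e_def)
    have "\<forall>\<^sub>F s in nhds t. (s \<in> T \<longrightarrow> \<bar>f t - f s - D * (t - s)\<bar> \<le> e * \<bar>t - s\<bar>) \<and>
        (s \<in> T \<longrightarrow> \<bar>f t - f s - D' * (t - s)\<bar> \<le> e * \<bar>t - s\<bar>)"
      using assms(1,2) e True unfolding has_delta_deriv_iff_eventually
      by (intro eventually_conj) auto
    then obtain d where d: "d > 0"
      "\<And>s. dist s t < d \<Longrightarrow> s \<in> T \<Longrightarrow> \<bar>f t - f s - D * (t - s)\<bar> \<le> e * \<bar>t - s\<bar>"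
      "\<And>s. dist s t < d \<Longrightarrow> s \<in> T \<Longrightarrow> \<bar>f t - f s - D' * (t - s)\<bar> \<le> e * \<bar>t - s\<bar>"
      by (auto simp: eventually_nhds_metric)
    obtain s where s: "s \<in> T" "t < s" "s < t + d"
      using right_dense_approx[OF True assms(4,5) d(1)] .
    have "\<bar>(D - D') * (t - s)\<bar> \<le> 2 * e * \<bar>t - s\<bar>"
      using d(2,3)[of s] s by (auto simp: dist_real_def algebra_simps)
    then have "\<bar>D - D'\<bar> \<le> 2 * e" using s by (simp add: abs_mult)
    then show False using \<open>D \<noteq> D'\<close> by (simp add: e_def)
  qed
qed

lemma delta_deriv_eq:
  assumes "has_delta_deriv T f t D" "t \<in> T" "u \<in> T" "t < u"
  shows "delta_deriv T f t = D"
  unfolding delta_deriv_def using assms by (blast intro: has_delta_deriv_unique)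

lemma has_delta_deriv_id: "has_delta_deriv T (\<lambda>t. t) t 1"
  by (simp add: has_delta_deriv_iff_eventually)

lemma has_delta_deriv_const: "has_delta_deriv T (\<lambda>t. c) t 0"
  by (simp add: has_delta_deriv_iff_eventually)

lemma has_delta_deriv_add:
  assumes "has_delta_deriv T f t D" "has_delta_deriv T g t E"
  shows "has_delta_deriv T (\<lambda>t. f t + g t) t (D + E)"
  unfolding has_delta_deriv_iff_eventually
proof (intro allI impI)
  fix e :: real assume "e > 0"
  let ?\<sigma> = "forward_jump T t"
  have "\<forall>\<^sub>F s in nhds t. (s \<in> T \<longrightarrow> \<bar>f ?\<sigma> - f s - D * (?\<sigma> - s)\<bar> \<le> e / 2 * \<bar>?\<sigma> - s\<bar>) \<and>
        (s \<in> T \<longrightarrow> \<bar>g ?\<sigma> - g s - E * (?\<sigma> - s)\<bar> \<le> e / 2 * \<bar>?\<sigma> - s\<bar>)"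
    using assms \<open>e > 0\<close> unfolding has_delta_deriv_iff_eventually
    by (intro eventually_conj) (meson half_gt_zero)+
  then show "\<forall>\<^sub>F s in nhds t. s \<in> T \<longrightarrow>
      \<bar>f ?\<sigma> + g ?\<sigma> - (f s + g s) - (D + E) * (?\<sigma> - s)\<bar> \<le> e * \<bar>?\<sigma> - s\<bar>"
  proof eventually_elim
    case (elim s)
    show ?case
    proof
      assume "s \<in> T"
      have "f ?\<sigma> + g ?\<sigma> - (f s + g s) - (D + E) * (?\<sigma> - s)
          = (f ?\<sigma> - f s - D * (?\<sigma> - s)) + (g ?\<sigma> - g s - E * (?\<sigma> - s))"
        by (simp add: algebra_simps)
      then show "\<bar>f ?\<sigma> + g ?\<sigma> - (f s + g s) - (D + E) * (?\<sigma> - s)\<bar> \<le> e * \<bar>?\<sigma> - s\<bar>"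
        using elim \<open>s \<in> T\<close> by linarith
    qed
  qed
qed

text \<open>The kernel is piecewise linear, so a product rule for linear factors is enough.
  Increments of the factor are exact; the error is that of \<open>f\<close> times a bounded factor,
  plus a term that carries s - t and tends to 0.\<close>

lemma has_delta_deriv_linear_mult:
  assumes "has_delta_deriv T f t D"
  shows "has_delta_deriv T (\<lambda>t. (c * t - d) * f t) t ((c * t - d) * D + c * f (forward_jump T t))"
  unfolding has_delta_deriv_iff_eventually
proof (intro allI impI)
  fix e :: real assume "e > 0"
  let ?\<sigma> = "forward_jump T t"
  define B where "B = \<bar>c * t - d\<bar> + 1"
  have B: "B > 0" by (simp add: B_def)
  have "((\<lambda>s. \<bar>c * s - d\<bar>) \<longlongrightarrow> \<bar>c * t - d\<bar>) (nhds t)"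
    by (intro tendsto_intros filterlim_ident)
  then have 1: "\<forall>\<^sub>F s in nhds t. \<bar>c * s - d\<bar> < B"
    by (rule order_tendstoD) (simp add: B_def)
  have "((\<lambda>s. \<bar>c * (s - t) * D\<bar>) \<longlongrightarrow> \<bar>c * (t - t) * D\<bar>) (nhds t)"
    by (intro tendsto_intros filterlim_ident)
  then have 2: "\<forall>\<^sub>F s in nhds t. \<bar>c * (s - t) * D\<bar> < e / 2"
    by (rule order_tendstoD) (use \<open>e > 0\<close> in simp)
  have "e / (2 * B) > 0" using B \<open>e > 0\<close> by simp
  then have 3: "\<forall>\<^sub>F s in nhds t. s \<in> T \<longrightarrow>
      \<bar>f ?\<sigma> - f s - D * (?\<sigma> - s)\<bar> \<le> e / (2 * B) * \<bar>?\<sigma> - s\<bar>"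
    using assms unfolding has_delta_deriv_iff_eventually by blast
  show "\<forall>\<^sub>F s in nhds t. s \<in> T \<longrightarrow>
      \<bar>(c * ?\<sigma> - d) * f ?\<sigma> - (c * s - d) * f s
        - ((c * t - d) * D + c * f ?\<sigma>) * (?\<sigma> - s)\<bar> \<le> e * \<bar>?\<sigma> - s\<bar>"
    using 1 2 3
  proof eventually_elim
    case (elim s)
    show ?case
    proof
      assume s: "s \<in> T"
      let ?R = "f ?\<sigma> - f s - D * (?\<sigma> - s)"
      have "(c * ?\<sigma> - d) * f ?\<sigma> - (c * s - d) * f s - ((c * t - d) * D + c * f ?\<sigma>) * (?\<sigma> - s)
          = (c * s - d) * ?R + (c * (s - t) * D) * (?\<sigma> - s)"
        by (simp add: algebra_simps)
      also have "\<bar>\<dots>\<bar> \<le> \<bar>c * s - d\<bar> * \<bar>?R\<bar> + \<bar>c * (s - t) * D\<bar> * \<bar>?\<sigma> - s\<bar>"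
        by (metis abs_mult abs_triangle_ineq)
      also have "\<bar>c * s - d\<bar> * \<bar>?R\<bar> \<le> B * (e / (2 * B) * \<bar>?\<sigma> - s\<bar>)"
        using elim s B by (intro mult_mono) auto
      also have "\<dots> = e / 2 * \<bar>?\<sigma> - s\<bar>" using B by (simp add: field_simps)
      also have "\<bar>c * (s - t) * D\<bar> * \<bar>?\<sigma> - s\<bar> \<le> e / 2 * \<bar>?\<sigma> - s\<bar>"
        using elim by (intro mult_right_mono) auto
      finally show "\<bar>(c * ?\<sigma> - d) * f ?\<sigma> - (c * s - d) * f s
        - ((c * t - d) * D + c * f ?\<sigma>) * (?\<sigma> - s)\<bar> \<le> e * \<bar>?\<sigma> - s\<bar>"
        by simp
    qed
  qed
qed

lemma has_delta_deriv_cmult: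
  "has_delta_deriv T f t D \<Longrightarrow> has_delta_deriv T (\<lambda>t. c * f t) t (c * D)"
  \<comment> \<open>Scalar multiplication is the case of the constant factor 0 * t - (-c).\<close>
  using has_delta_deriv_linear_mult[of T f t D 0 "-c"] by simp

lemma has_delta_deriv_diff:
  assumes "has_delta_deriv T f t D" "has_delta_deriv T g t E"
  shows "has_delta_deriv T (\<lambda>t. f t - g t) t (D - E)"
  using has_delta_deriv_add[OF assms(1) has_delta_deriv_cmult[OF assms(2), of "-1"]] by simp

text \<open>Links h_2, which is formed over \<open>T\<close>, to the estimates, which live on [a,b].
  Truncation keeps the jump of every t < b, since a point of \<open>T\<close> beyond
  \<open>b\<close> can be replaced by \<open>b\<close> itself.\<close>

lemma has_delta_deriv_Int_atLeastAtMost: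
  assumes "has_delta_deriv T f t D" "t \<in> T" "b \<in> T" "a \<le> t" "t < b"
  shows "has_delta_deriv (T \<inter> {a..b}) f t D"
proof -
  have "forward_jump (T \<inter> {a..b}) t = forward_jump T t"
  proof -
    have "Inf {s \<in> T \<inter> {a..b}. t < s} = Inf {s \<in> T. t < s}"
    proof (rule antisym)
      show "Inf {s \<in> T. t < s} \<le> Inf {s \<in> T \<inter> {a..b}. t < s}"
        using assms by (intro cInf_superset_mono) (auto intro!: bdd_belowI[of _ t] exI[of _ b])
      show "Inf {s \<in> T \<inter> {a..b}. t < s} \<le> Inf {s \<in> T. t < s}"
      proof (rule cInf_mono)
        show "{s \<in> T. t < s} \<noteq> {}" using assms by auto
        show "bdd_below {s \<in> T \<inter> {a..b}. t < s}" by (auto intro!: bdd_belowI[of _ t])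
        fix u assume "u \<in> {s \<in> T. t < s}"
        then show "\<exists>v\<in>{s \<in> T \<inter> {a..b}. t < s}. v \<le> u"
          using assms by (intro bexI[of _ "min u b"]) (auto simp: min_def)
      qed
    qed
    moreover have "\<exists>s\<in>T \<inter> {a..b}. t < s" "\<exists>s\<in>T. t < s" using assms by auto
    ultimately show ?thesis by (simp add: forward_jump_def)
  qed
  then show ?thesis using assms(1) unfolding has_delta_deriv_def by fastforce
qed

section \<open>The mean value inequality\<close>

lemma delta_mono_aux:
  assumes S: "closed S" "c \<in> S" "d \<in> S" "c \<le> d" and w: "continuous_on S w"
    and D: "\<And>t. t \<in> S \<Longrightarrow> c \<le> t \<Longrightarrow> t < d \<Longrightarrow> \<exists>D\<ge>0. has_delta_deriv S w t D"
  shows "w c \<le> w d"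
proof -
  have "w c - w d \<le> 0 + e" if "e > 0" for e
  proof -
    \<comment> \<open>A slope allowance that costs at most \<open>e\<close> over the whole interval;
      the added 1 covers c = d.\<close>
    define k where "k = e / (d - c + 1)"
    have k: "k > 0" using S that by (simp add: k_def)
    \<comment> \<open>Continuous induction: \<open>A\<close> is compact and so has a last point
      \<open>s\<close>. If s < d, then \<sigma>(s) in the right-scattered case, or a nearby point to
      the right in the right-dense case, is a later point of \<open>A\<close>.\<close>
    define A where "A = (S \<inter> {c..d}) \<inter> (\<lambda>t. w t - w c + k * (t - c)) -` {0..}"
    have "closed A" unfolding A_def
      by (intro continuous_closed_preimage closed_Int S closed_atLeastAtMost closed_atLeast
           continuous_intros continuous_on_subset[OF w]) auto
    moreover have "bounded A" unfolding A_def
      by (rule bounded_subset[of "{c..d}"]) auto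
    ultimately have "compact A" by (simp add: compact_eq_bounded_closed)
    moreover have "c \<in> A" using S by (simp add: A_def)
    ultimately obtain s where s: "s \<in> A" "\<And>t. t \<in> A \<Longrightarrow> t \<le> s"
      using compact_attains_sup[of A] by blast
    have sS: "s \<in> S" "c \<le> s" "s \<le> d" "w s - w c + k * (s - c) \<ge> 0"
      using s(1) by (auto simp: A_def)
    have "s = d"
    proof (rule ccontr)
      assume "s \<noteq> d"
      then have "s < d" using sS by simp
      then obtain D where "D \<ge> 0" and D': "has_delta_deriv S w s D" using D sS by blast
      let ?\<sigma> = "forward_jump S s"
      have "\<exists>u\<in>S. s < u \<and> u \<le> d \<and> w s - w u \<le> k * (u - s)"
      proof (cases "?\<sigma> = s")
        case False
        then have "s < ?\<sigma>" using forward_jump_ge[of s S] by simp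
        moreover have "?\<sigma> \<in> S" "?\<sigma> \<le> d"
          using forward_jump_in[of S s] forward_jump_le[of d S s] S sS \<open>s < d\<close> by auto
        moreover have "w s - w ?\<sigma> \<le> k * (?\<sigma> - s)"
        proof -
          have "D * (?\<sigma> - s) \<ge> 0" "k * (?\<sigma> - s) \<ge> 0" using \<open>D \<ge> 0\<close> \<open>s < ?\<sigma>\<close> k by auto
          then show ?thesis using has_delta_deriv_jump[OF D' sS(1)] by linarith
        qed
        ultimately show ?thesis by blast
      next
        case True
        have "\<forall>\<^sub>F u in nhds s. u \<in> S \<longrightarrow> \<bar>w s - w u - D * (s - u)\<bar> \<le> k * \<bar>s - u\<bar>"
          using D' k True unfolding has_delta_deriv_iff_eventually by fastforce
        then obtain \<delta> where \<delta>: "\<delta> > 0"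
          "\<And>u. dist u s < \<delta> \<Longrightarrow> u \<in> S \<Longrightarrow> \<bar>w s - w u - D * (s - u)\<bar> \<le> k * \<bar>s - u\<bar>"
          by (auto simp: eventually_nhds_metric)
        obtain u where u: "u \<in> S" "s < u" "u < s + min \<delta> (d - s)"
          using right_dense_approx[OF True S(3) \<open>s < d\<close>, of "min \<delta> (d - s)"] \<delta>(1) \<open>s < d\<close> by auto
        have "\<bar>w s - w u - D * (s - u)\<bar> \<le> k * \<bar>s - u\<bar>"
          using u \<delta>(2)[of u] by (auto simp: dist_real_def)
        moreover have "D * (u - s) \<ge> 0" using \<open>D \<ge> 0\<close> u by simp
        ultimately have "w s - w u \<le> k * (u - s)"
          using u by (simp add: algebra_simps abs_if split: if_splits)
        then show ?thesis using u by (intro bexI[of _ u]) auto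
      qed
      then obtain u where u: "u \<in> S" "s < u" "u \<le> d" "w s - w u \<le> k * (u - s)" by blast
      have "u \<in> A" using u sS by (auto simp: A_def algebra_simps)
      then show False using s(2)[of u] u by simp
    qed
    then have "w c - w d \<le> k * (d - c)" using sS by simp
    also have "\<dots> \<le> e" using S that by (simp add: k_def field_simps)
    finally show ?thesis by simp
  qed
  then have "w c - w d \<le> 0" by (rule field_le_epsilon)
  then show ?thesis by simp
qed

text \<open>At a right-dense left endpoint, continuity replaces the condition on the derivative.\<close>

lemma delta_mono:
  assumes S: "closed S" "c \<in> S" "d \<in> S" "c \<le> d" and w: "continuous_on S w"
    and D: "\<And>t. t \<in> S \<Longrightarrow> c \<le> t \<Longrightarrow> t < d \<Longrightarrow> c < t \<or> c < forward_jump S c \<Longrightarrow>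
              \<exists>D\<ge>0. has_delta_deriv S w t D"
  shows "w c \<le> w d"
proof (cases "c < forward_jump S c \<or> c = d")
  case True
  then show ?thesis using delta_mono_aux[OF assms(1-5)] D by auto
next
  case False
  then have rd: "forward_jump S c = c" and "c < d"
    using forward_jump_ge[of c S] S by auto
  show ?thesis
  proof (rule ccontr)
    assume "\<not> w c \<le> w d"
    then have "w c - w d > 0" by simp
    then obtain \<delta> where \<delta>: "\<delta> > 0" "\<And>u. u \<in> S \<Longrightarrow> dist u c < \<delta> \<Longrightarrow> dist (w u) (w c) < w c - w d"
      using w S(2) unfolding continuous_on_iff by blast
    obtain u where u: "u \<in> S" "c < u" "u < c + min \<delta> (d - c)"
      using right_dense_approx[OF rd S(3) \<open>c < d\<close>, of "min \<delta> (d - c)"] \<delta>(1) \<open>c < d\<close> by auto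
    have "w u \<le> w d"
      using u D by (intro delta_mono_aux[OF S(1) _ S(3) _ w]) auto
    moreover have "dist (w u) (w c) < w c - w d" using \<delta>(2)[of u] u by (auto simp: dist_real_def)
    ultimately show False by (auto simp: dist_real_def)
  qed
qed

lemma delta_compare:
  assumes "closed S" "c \<in> S" "d \<in> S" "c \<le> d" "continuous_on S u" "continuous_on S v"
    and D: "\<And>t. t \<in> S \<Longrightarrow> c \<le> t \<Longrightarrow> t < d \<Longrightarrow> c < t \<or> c < forward_jump S c \<Longrightarrow>
              \<exists>D E. has_delta_deriv S u t D \<and> has_delta_deriv S v t E \<and> D \<le> E"
  shows "u d - u c \<le> v d - v c"
proof -
  have "(\<lambda>t. v t - u t) c \<le> (\<lambda>t. v t - u t) d"
    using assms(1-4)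
  proof (rule delta_mono)
    show "continuous_on S (\<lambda>t. v t - u t)" using assms by (intro continuous_intros)
    fix t assume "t \<in> S" "c \<le> t" "t < d" "c < t \<or> c < forward_jump S c"
    then obtain D E where "has_delta_deriv S u t D" "has_delta_deriv S v t E" "D \<le> E"
      using D by blast
    then show "\<exists>D\<ge>0. has_delta_deriv S (\<lambda>t. v t - u t) t D"
      using has_delta_deriv_diff[of S v t E u D] by (intro exI[of _ "E - D"]) auto
  qed
  then show ?thesis by simp
qed

section \<open>Delta integrals and the existence of antiderivatives\<close>

lemma delta_antiderivative_continuous_on:
  "delta_antiderivative T g F \<Longrightarrow> continuous_on T F"
  by (rule continuous_on_of_delta_deriv) (auto simp: delta_antiderivative_def)

text \<open>Comparing two antiderivatives in both directions shows that they have equal increments,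
  so the description by \<open>THE\<close> is unambiguous, for either order of \<open>c\<close> and
  \<open>d\<close>.\<close>

lemma delta_integral_eq:
  assumes "closed T" "c \<in> T" "d \<in> T" and F: "delta_antiderivative T g F"
  shows "delta_integral T c d g = F d - F c"
proof -
  have le: "G v - G u = F v - F u"
    if "delta_antiderivative T g G" "u \<in> T" "v \<in> T" "u \<le> v" for G u v
  proof -
    have *: "\<exists>D E. has_delta_deriv T G t D \<and> has_delta_deriv T F t E \<and> D = E"
      if "t \<in> T" "t < v" for t
      using \<open>delta_antiderivative T g G\<close> F in_ts_kappa[OF that(1) \<open>v \<in> T\<close> that(2)]
      unfolding delta_antiderivative_def by blast
    note cont = delta_antiderivative_continuous_on
    show ?thesis
      using delta_compare[OF assms(1) that(2,3,4) cont[OF that(1)] cont[OF F]]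
        delta_compare[OF assms(1) that(2,3,4) cont[OF F] cont[OF that(1)]] *
      by (smt (verit, best))
  qed
  have "G d - G c = F d - F c" if "delta_antiderivative T g G" for G
    using le[OF that, of c d] le[OF that, of d c] assms(2,3) by linarith
  then show ?thesis unfolding delta_integral_def using F by blast
qed

lemma has_delta_deriv_of_antiderivative:
  assumes "delta_antiderivative T g F" "t \<in> T" "u \<in> T" "t < u"
  shows "has_delta_deriv T F t (g t)"
  using assms in_ts_kappa unfolding delta_antiderivative_def by blast

text \<open>A monotone retraction of the line onto a closed \<open>T\<close> that sends each point
  of a gap to the left end of the gap. The default \<open>Inf T\<close> to the left of
  \<open>T\<close> keeps it monotone and with values in \<open>T\<close>.\<close>

definition last_before :: "real set \<Rightarrow> real \<Rightarrow> real" where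
  "last_before T \<tau> = (if \<exists>u\<in>T. u \<le> \<tau> then Sup {u \<in> T. u \<le> \<tau>} else Inf T)"

lemma last_before_ge: "u \<in> T \<Longrightarrow> u \<le> \<tau> \<Longrightarrow> u \<le> last_before T \<tau>"
  unfolding last_before_def by (auto intro!: cSup_upper bdd_aboveI[of _ \<tau>])

lemma last_before_le: "u \<in> T \<Longrightarrow> u \<le> \<tau> \<Longrightarrow> last_before T \<tau> \<le> \<tau>"
  unfolding last_before_def by (auto intro!: cSup_least)

lemma last_before_in:
  assumes "closed T" "T \<noteq> {}"
  shows "last_before T \<tau> \<in> T"
proof (cases "\<exists>u\<in>T. u \<le> \<tau>")
  case True
  then have "Sup {u \<in> T. u \<le> \<tau>} \<in> closure {u \<in> T. u \<le> \<tau>}"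
    by (intro closure_contains_Sup) (auto intro!: bdd_aboveI[of _ \<tau>])
  also have "\<dots> \<subseteq> T"
    using assms(1) by (intro closure_minimal) auto
  finally show ?thesis using True by (simp add: last_before_def)
next
  case False
  then have "bdd_below T" by (intro bdd_belowI[of _ \<tau>]) auto
  then show ?thesis using False assms by (simp add: last_before_def closed_contains_Inf)
qed

lemma last_before_mono:
  assumes "closed T" "T \<noteq> {}"
  shows "mono (last_before T)"
proof
  fix x y :: real assume "x \<le> y"
  show "last_before T x \<le> last_before T y"
  proof (cases "\<exists>u\<in>T. u \<le> x")
    case True
    then have "last_before T x \<le> x" using last_before_le by blast
    then show ?thesis using \<open>x \<le> y\<close> last_before_in[OF assms]
      by (intro last_before_ge) auto
  next
    case False
    then have "bdd_below T" by (intro bdd_belowI[of _ x]) auto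
    then show ?thesis
      using False last_before_in[OF assms, of y] by (simp add: last_before_def[of T x] cInf_lower)
  qed
qed

text \<open>\<open>F\<close> is the primitive based at 0: one of its two integrals always vanishes.
  Its increment minus c * (v - u) is the integral of k - c, and a bound on the open interval
  suffices because the two endpoints are negligible.\<close>

lemma integral_difference_bound:
  fixes k :: "real \<Rightarrow> real"
  assumes int: "\<And>u v. k integrable_on {u..v}"
  defines "F \<equiv> \<lambda>t. integral {0..t} k - integral {t..0} k"
  assumes "u \<le> v" "K \<ge> 0" and K: "\<And>\<tau>. u < \<tau> \<Longrightarrow> \<tau> < v \<Longrightarrow> \<bar>k \<tau> - c\<bar> \<le> K"
  shows "\<bar>F v - F u - c * (v - u)\<bar> \<le> K * (v - u)"
proof -
  have neg: "integral {x..y} k = 0" if "y \<le> x" for x y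
    using that by (cases "x = y") auto
  have "F v - F u = integral {u..v} k"
    using \<open>u \<le> v\<close> Henstock_Kurzweil_Integration.integral_combine[OF _ _ int, of 0 u v] Henstock_Kurzweil_Integration.integral_combine[OF _ _ int, of u 0 v]
      Henstock_Kurzweil_Integration.integral_combine[OF _ _ int, of u v 0] neg[of u 0] neg[of v 0] neg[of 0 u] neg[of 0 v]
    unfolding F_def by linarith
  then have "(k has_integral (F v - F u)) (cbox u v)"
    using int[of u v] by (simp add: has_integral_integrable_integral)
  moreover have "((\<lambda>_. c) has_integral (c * (v - u))) (cbox u v)"
    using has_integral_const[of c u v] \<open>u \<le> v\<close> by (simp add: mult.commute)
  ultimately have "((\<lambda>\<tau>. k \<tau> - c) has_integral (F v - F u - c * (v - u))) (cbox u v)"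
    by (rule has_integral_diff)
  then have "norm (F v - F u - c * (v - u)) \<le> K * measure lborel (cbox u v)"
    by (rule has_integral_bound_spike_finite[OF \<open>K \<ge> 0\<close>, of "{u, v}", rotated]) (use K in auto)
  then show ?thesis using \<open>u \<le> v\<close> by simp
qed

text \<open>The antiderivative is the ordinary integral of the step extension that is constant on
  each gap of \<open>T\<close>; writing the integrand as \<open>f \<circ> q\<close> with \<open>q\<close> monotone makes it measurable.\<close>

lemma delta_antiderivative_exists:
  assumes T: "closed T" "T \<noteq> {}" and f: "continuous_on T f"
    and q: "mono_on T q" "q ` T \<subseteq> T"
    and rd: "\<And>t. t \<in> T \<Longrightarrow> forward_jump T t = t \<Longrightarrow> continuous (at t within T) (\<lambda>s. f (q s))"
  shows "\<exists>F. delta_antiderivative T (\<lambda>t. f (q t)) F"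
proof -
  note in_T = last_before_in[OF T]
  \<comment> \<open>With f' continuous on the whole line and \<open>p\<close> monotone, their
    composition is Borel; it is bounded on [u,v] because \<open>p\<close> maps [u,v] into
    [p u, p v].\<close>
  obtain f' where f': "continuous_on UNIV f'" "\<And>t. t \<in> T \<Longrightarrow> f' t = f t"
    using Tietze_unbounded[OF f, of UNIV] T(1) by auto
  define p where "p \<tau> = q (last_before T \<tau>)" for \<tau>
  have p: "mono p"
    using q(1) last_before_mono[OF T] in_T by (auto simp: p_def mono_def mono_on_def)
  define k where "k \<tau> = f' (p \<tau>)" for \<tau>
  have k_eq: "k \<tau> = f (q (last_before T \<tau>))" for \<tau>
    using q(2) in_T by (auto simp: k_def p_def intro!: f')
  have bounded: "\<exists>B. \<forall>\<tau>\<in>{u..v}. \<bar>k \<tau>\<bar> \<le> B" for u v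
  proof -
    have "compact (f' ` {p u..p v})"
      using f'(1) by (intro compact_continuous_image) (auto intro: continuous_on_subset)
    then obtain B where B: "\<And>y. y \<in> f' ` {p u..p v} \<Longrightarrow> norm y \<le> B"
      by (meson bounded_iff compact_imp_bounded)
    have "\<bar>k \<tau>\<bar> \<le> B" if "\<tau> \<in> {u..v}" for \<tau>
      using that p B[of "k \<tau>"] by (auto simp: k_def mono_def)
    then show ?thesis by blast
  qed
  have "p \<in> borel_measurable borel" using p by (rule borel_measurable_mono)
  then have "k \<in> borel_measurable borel"
    unfolding k_def using borel_measurable_continuous_on[OF f'(1)] by blast
  then have meas: "k \<in> borel_measurable (lebesgue_on S)" for S
    by (intro measurable_restrict_space1 measurable_completion) simp
  have int: "k integrable_on {u..v}" for u v
  proof -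
    obtain B where B: "\<forall>\<tau>\<in>{u..v}. \<bar>k \<tau>\<bar> \<le> B" using bounded by blast
    show ?thesis
      using B by (intro measurable_bounded_by_integrable_imp_integrable[OF meas, where g = "\<lambda>_. B"]) auto
  qed
  define F where "F t = integral {0..t} k - integral {t..0} k" for t
  note bound = integral_difference_bound[OF int, folded F_def]
  have "has_delta_deriv T F t (f (q t))" if t: "t \<in> T" for t
    unfolding has_delta_deriv_iff_eventually
  proof (intro allI impI)
    fix e :: real assume "e > 0"
    let ?\<sigma> = "forward_jump T t"
    show "\<forall>\<^sub>F s in nhds t. s \<in> T \<longrightarrow> \<bar>F ?\<sigma> - F s - f (q t) * (?\<sigma> - s)\<bar> \<le> e * \<bar>?\<sigma> - s\<bar>"
    proof (cases "?\<sigma> = t")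
      case True
      then obtain d where d: "d > 0"
        "\<And>s. s \<in> T \<Longrightarrow> \<bar>s - t\<bar> < d \<Longrightarrow> \<bar>f (q s) - f (q t)\<bar> < e"
        using rd[OF t True] \<open>e > 0\<close> unfolding continuous_within_eps_delta dist_real_def by metis
      \<comment> \<open>For \<tau> between \<open>s\<close> and \<open>t\<close>, the last point of
        \<open>T\<close> up to \<tau> also lies between them, so continuity at \<open>t\<close>
        applies to it.\<close>
      have near: "\<bar>k \<tau> - f (q t)\<bar> \<le> e" if "s \<in> T" "\<bar>s - t\<bar> < d" "min s t < \<tau>" "\<tau> < max s t" for s \<tau>
      proof -
        have "min s t \<le> last_before T \<tau>" "last_before T \<tau> \<le> \<tau>"
          using that t last_before_ge[of "min s t" T \<tau>] last_before_le[of "min s t" T \<tau>]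
          by (auto simp: min_def split: if_splits)
        then have "\<bar>last_before T \<tau> - t\<bar> < d" using that by (auto simp: min_def max_def split: if_splits)
        then show ?thesis using d(2)[OF in_T] by (simp add: k_eq less_imp_le)
      qed
      have "\<bar>F t - F s - f (q t) * (t - s)\<bar> \<le> e * \<bar>t - s\<bar>" if "s \<in> T" "dist s t < d" for s
      proof (cases "s \<le> t")
        case True
        then show ?thesis using bound[of s t e "f (q t)"] near[of s] that \<open>e > 0\<close>
          by (auto simp: dist_real_def)
      next
        case False
        then have "\<bar>F s - F t - f (q t) * (s - t)\<bar> \<le> e * (s - t)"
          using near[of s] that \<open>e > 0\<close> by (intro bound) (auto simp: dist_real_def)
        moreover have "F s - F t - f (q t) * (s - t) = - (F t - F s - f (q t) * (t - s))"
          by (simp add: algebra_simps)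
        ultimately show ?thesis using False by simp
      qed
      then show ?thesis using d(1) True by (auto simp: eventually_nhds_metric)
    next
      case False
      then have \<sigma>: "t < ?\<sigma>" using forward_jump_ge[of t T] by simp
      \<comment> \<open>The step extension is constant on the gap, so the increment across the gap
        is exact.\<close>
      have "last_before T \<tau> = t" if "t < \<tau>" "\<tau> < ?\<sigma>" for \<tau>
        using last_before_ge[of t T \<tau>] last_before_le[of t T \<tau>] that t in_T[of \<tau>]
          forward_jump_le[of "last_before T \<tau>" T t] by fastforce
      then have "\<bar>F ?\<sigma> - F t - f (q t) * (?\<sigma> - t)\<bar> \<le> 0 * (?\<sigma> - t)"
        using \<sigma> by (intro bound) (auto simp: k_eq)
      then have jump: "F ?\<sigma> - F t = f (q t) * (?\<sigma> - t)" by simp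
      obtain B where B: "\<forall>\<tau>\<in>{t - 1..t}. \<bar>k \<tau>\<bar> \<le> B" using bounded by blast
      define C where "C = \<bar>B\<bar> + \<bar>f (q t)\<bar> + 1"
      have C: "C > 0" by (simp add: C_def add_nonneg_pos)
      \<comment> \<open>To the left of \<open>t\<close> the integrand is merely bounded, so the
        error is at most C * (t - s), to be compared with e * (\<sigma> - t). The bound 1 keeps
        \<open>s\<close> where \<open>B\<close> is valid, and \<sigma> - t keeps \<open>s\<close>
        from lying to the right of \<open>t\<close>.\<close>
      define d where "d = Min {1, ?\<sigma> - t, e * (?\<sigma> - t) / C}"
      have d: "d > 0" using \<open>e > 0\<close> C \<sigma> by (simp add: d_def)
      have "\<bar>F ?\<sigma> - F s - f (q t) * (?\<sigma> - s)\<bar> \<le> e * \<bar>?\<sigma> - s\<bar>" if s: "s \<in> T" "dist s t < d" for s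
      proof -
        have "\<bar>s - t\<bar> < ?\<sigma> - t" using s by (simp add: d_def dist_real_def)
        then have "s \<le> t" using s(1) forward_jump_le[of s T t] by (cases "s \<le> t") auto
        have "t - 1 \<le> s" using s by (auto simp: d_def dist_real_def)
        have "F ?\<sigma> - F s - f (q t) * (?\<sigma> - s) = F t - F s - f (q t) * (t - s)"
          using jump by (simp add: algebra_simps)
        also have "\<bar>\<dots>\<bar> \<le> C * (t - s)"
        proof (rule bound[OF \<open>s \<le> t\<close>])
          fix \<tau> assume "s < \<tau>" "\<tau> < t"
          then have "\<bar>k \<tau>\<bar> \<le> B" using B \<open>t - 1 \<le> s\<close> by auto
          then show "\<bar>k \<tau> - f (q t)\<bar> \<le> C" by (simp add: C_def)
        qed (use C in simp)
        also have "\<dots> \<le> C * (e * (?\<sigma> - t) / C)"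
          using s C by (intro mult_left_mono) (auto simp: d_def dist_real_def)
        also have "\<dots> = e * (?\<sigma> - t)" using C by simp
        also have "\<dots> \<le> e * \<bar>?\<sigma> - s\<bar>"
          using \<open>s \<le> t\<close> \<sigma> \<open>e > 0\<close> by (intro mult_left_mono) auto
        finally show ?thesis .
      qed
      then show ?thesis using d by (auto simp: eventually_nhds_metric)
    qed
  qed
  then show ?thesis by (auto simp: delta_antiderivative_def ts_kappa_def)
qed

lemma delta_antiderivative_exists_continuous:
  assumes "closed T" "T \<noteq> {}" "continuous_on T f"
  shows "\<exists>F. delta_antiderivative T f F"
  using assms delta_antiderivative_exists[of T f "\<lambda>t. t"]
  by (auto simp: mono_on_def continuous_on_eq_continuous_within)

section \<open>Composition with the forward jump\<close>

lemma forward_jump_mono: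
  assumes "t \<in> T" "s \<le> t"
  shows "forward_jump T s \<le> forward_jump T t"
  using assms forward_jump_le[of t T s] forward_jump_ge[of t T] by (cases "s = t") auto

text \<open>A point \<open>u\<close> of \<open>T\<close> just to the right of \<open>t\<close> traps
  \<sigma>(s) between \<open>s\<close> and \<open>u\<close> for all s < u. If \<open>t\<close> is
  the maximum, \<sigma>(s) is trapped between \<open>s\<close> and \<open>t\<close>.\<close>

lemma continuous_forward_jump:
  assumes "closed T" "t \<in> T" "forward_jump T t = t"
  shows "continuous (at t within T) (forward_jump T)"
proof -
  have "\<exists>d>0. \<forall>s\<in>T. \<bar>s - t\<bar> < d \<longrightarrow> \<bar>forward_jump T s - t\<bar> < e" if "e > 0" for e
  proof (cases "\<exists>u\<in>T. t < u")
    case True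
    then obtain u where u: "u \<in> T" "t < u" "u < t + e"
      using right_dense_approx[OF assms(3), of _ e] \<open>e > 0\<close> by blast
    have "\<bar>forward_jump T s - t\<bar> < e" if "s \<in> T" "\<bar>s - t\<bar> < u - t" for s
    proof -
      have "s < u" using that by auto
      then show ?thesis
        using forward_jump_le[of u T s] forward_jump_ge[of s T] that u by (auto simp: abs_if split: if_splits)
    qed
    then show ?thesis using u by (intro exI[of _ "u - t"]) auto
  next
    case False
    have "\<bar>forward_jump T s - t\<bar> < e" if "s \<in> T" "\<bar>s - t\<bar> < e" for s
      using that False forward_jump_mono[OF assms(2), of s] forward_jump_ge[of s T] assms(3)
      by (auto simp: abs_if not_less split: if_splits)
    then show ?thesis using \<open>e > 0\<close> by blast
  qed
  then show ?thesis using assms(3) by (simp add: continuous_within_eps_delta dist_real_def)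
qed

text \<open>The jump operator is monotone but discontinuous at left-dense, right-scattered points;
  the existence result asks for continuity only at right-dense ones.\<close>

lemma delta_antiderivative_exists_forward_jump:
  assumes "closed T" "T \<noteq> {}" and f: "continuous_on T f"
  shows "\<exists>F. delta_antiderivative T (\<lambda>t. f (forward_jump T t)) F"
proof (rule delta_antiderivative_exists[OF assms])
  show "mono_on T (forward_jump T)" using forward_jump_mono by (auto simp: mono_on_def)
  show im: "forward_jump T ` T \<subseteq> T" using forward_jump_in[OF assms(1)] by blast
  fix t assume t: "t \<in> T" "forward_jump T t = t"
  have "continuous (at t within T) f" using f t by (simp add: continuous_on_eq_continuous_within)
  then have "continuous (at (forward_jump T t) within forward_jump T ` T) f"
    using im t(2) continuous_within_subset by metis
  then show "continuous (at t within T) (\<lambda>s. f (forward_jump T s))"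
    using continuous_within_compose2[OF continuous_forward_jump[OF assms(1) t]] by blast
qed

section \<open>The monomial h_2 and comparison against a linear kernel\<close>

text \<open>G t - s * t is an antiderivative of t - s, so one antiderivative \<open>G\<close> of the
  identity serves every base point \<open>s\<close>.\<close>

lemma ts_monomial_2:
  assumes T: "closed T" "s \<in> T" "t \<in> T" and G: "delta_antiderivative T (\<lambda>t. t) G"
  shows "ts_monomial T 2 t s = (G t - s * t) - (G s - s * s)"
proof -
  have 1: "delta_antiderivative T (\<lambda>_. 1) (\<lambda>t. t)"
    by (simp add: delta_antiderivative_def has_delta_deriv_id)
  have h1: "ts_monomial T (Suc 0) \<tau> s = \<tau> - s" if "\<tau> \<in> T" for \<tau>
    using delta_integral_eq[OF T(1,2) that 1] by simp
  have "delta_antiderivative T (\<lambda>\<tau>. ts_monomial T (Suc 0) \<tau> s) (\<lambda>t. G t - s * t)"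
    unfolding delta_antiderivative_def
  proof
    fix \<tau> assume \<tau>: "\<tau> \<in> ts_kappa T"
    then have "has_delta_deriv T G \<tau> \<tau>" using G by (simp add: delta_antiderivative_def)
    from has_delta_deriv_diff[OF this has_delta_deriv_cmult[OF has_delta_deriv_id]]
    have "has_delta_deriv T (\<lambda>t. G t - s * t) \<tau> (\<tau> - s * 1)" .
    then show "has_delta_deriv T (\<lambda>t. G t - s * t) \<tau> (ts_monomial T (Suc 0) \<tau> s)"
      using h1 \<tau> by (simp add: ts_kappa_def del: ts_monomial.simps)
  qed
  then show ?thesis
    using delta_integral_eq[OF T(1-3)] by (simp add: numeral_2_eq_2 del: One_nat_def)
qed

text \<open>By the product rule (t - \<alpha>) f - \<Phi> has derivative (t - \<alpha>) D, since the
  terms with f(\<sigma>(t)) cancel. The sign \<open>q\<close> selects the side of an absolute value,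
  and \<open>L\<close> leaves room for the losses in the sharpness argument.\<close>

lemma weighted_delta_compare:
  fixes f \<Phi> V D :: "real \<Rightarrow> real"
  assumes S: "closed S" "c \<in> S" "d \<in> S" "c \<le> d"
    and cont: "continuous_on S f" "continuous_on S \<Phi>" "continuous_on S V"
    and f: "\<And>t. t \<in> S \<Longrightarrow> t < d \<Longrightarrow> has_delta_deriv S f t (D t)"
    and \<Phi>: "\<And>t. t \<in> S \<Longrightarrow> t < d \<Longrightarrow> has_delta_deriv S \<Phi> t (f (forward_jump S t))"
    and V: "\<And>t. t \<in> S \<Longrightarrow> c \<le> t \<Longrightarrow> t < d \<Longrightarrow> has_delta_deriv S V t (t - \<alpha>)"
    and le: "\<And>t. t \<in> S \<Longrightarrow> c \<le> t \<Longrightarrow> t < d \<Longrightarrow> c < t \<or> c < forward_jump S c \<Longrightarrow>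
              q * ((t - \<alpha>) * D t) \<le> K * (t - \<alpha>) + L"
  shows "q * (((d - \<alpha>) * f d - \<Phi> d) - ((c - \<alpha>) * f c - \<Phi> c)) \<le> K * (V d - V c) + L * (d - c)"
proof -
  have "(\<lambda>t. q * ((t - \<alpha>) * f t - \<Phi> t)) d - (\<lambda>t. q * ((t - \<alpha>) * f t - \<Phi> t)) c
      \<le> (\<lambda>t. K * V t + L * t) d - (\<lambda>t. K * V t + L * t) c"
  proof (rule delta_compare[OF S])
    fix t assume t: "t \<in> S" "c \<le> t" "t < d" "c < t \<or> c < forward_jump S c"
    have "has_delta_deriv S (\<lambda>t. q * ((t - \<alpha>) * f t - \<Phi> t)) t
        (q * (((t - \<alpha>) * D t + f (forward_jump S t)) - f (forward_jump S t)))"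
      using has_delta_deriv_linear_mult[OF f[OF t(1,3)], of 1 \<alpha>]
      by (intro has_delta_deriv_cmult has_delta_deriv_diff \<Phi> t) auto
    moreover have "has_delta_deriv S (\<lambda>t. K * V t + L * t) t (K * (t - \<alpha>) + L * 1)"
      by (intro has_delta_deriv_add has_delta_deriv_cmult has_delta_deriv_id V t)
    ultimately show "\<exists>D E. has_delta_deriv S (\<lambda>t. q * ((t - \<alpha>) * f t - \<Phi> t)) t D \<and>
        has_delta_deriv S (\<lambda>t. K * V t + L * t) t E \<and> D \<le> E"
      using le[OF t] by (intro exI conjI) auto
  qed (intro continuous_intros cont)+
  then show ?thesis by (simp add: algebra_simps)
qed

section \<open>Ingredients of nearly extremal functions\<close>

text \<open>Provides room for a sign change just before \<open>x\<close>: on [y,x] it either falls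
  into a gap of \<open>S\<close> or takes less than length \<epsilon>. Without points of
  \<open>S\<close> close to \<open>x\<close> on the left, the last point of \<open>S\<close> up to
  max \<alpha> (x - \<epsilon>) does it.\<close>

lemma left_neighbour:
  fixes S :: "real set"
  assumes "closed S" "\<alpha> \<in> S" "\<alpha> < x" "\<epsilon> > 0"
  obtains y where "y \<in> S" "\<alpha> \<le> y" "y < x" "(\<forall>t\<in>S. y \<le> t \<longrightarrow> t < x \<longrightarrow> t = y) \<or> x - y < \<epsilon>"
proof (cases "\<exists>u\<in>S. max \<alpha> (x - \<epsilon>) < u \<and> u < x")
  case True
  then show thesis using that by fastforce
next
  case False
  let ?A = "S \<inter> {\<alpha>..max \<alpha> (x - \<epsilon>)}"
  have "compact ?A" using assms(1) by (intro closed_Int_compact) auto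
  moreover have "\<alpha> \<in> ?A" using assms by auto
  ultimately obtain y where y: "y \<in> ?A" "\<And>t. t \<in> ?A \<Longrightarrow> t \<le> y"
    using compact_attains_sup[of ?A] by blast
  have "t = y" if "t \<in> S" "y \<le> t" "t < x" for t
    using y(1) y(2)[of t] False that by fastforce
  then show thesis using y(1) assms by (intro that[of y]) auto
qed

text \<open>A continuous function that takes the values \<open>-1\<close>, \<open>1\<close>, \<open>-1\<close>, \<open>1\<close> in this order, as the
  kernel of the Montgomery identity does. The first and third sign changes are ramps to the right
  of the zeros \<open>\<alpha>\<close> and \<open>\<beta>\<close> of the kernel; the one at its jump \<open>x\<close> has to take place on
  \<open>[y, x]\<close>, because \<open>x\<close> may be right-scattered and then has positive weight.\<close>

definition transition :: "real \<Rightarrow> real \<Rightarrow> real \<Rightarrow> real \<Rightarrow> real \<Rightarrow> real \<Rightarrow> real" where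
  "transition \<epsilon> \<alpha> y x \<beta> t = max (-1) (min 1
     (max (min ((t - \<alpha>) / \<epsilon> - 1) (2 * (x - t) / (x - y) - 1)) ((t - \<beta>) / \<epsilon> - 1)))"

lemma transition_bounds: "-1 \<le> transition \<epsilon> \<alpha> y x \<beta> t" "transition \<epsilon> \<alpha> y x \<beta> t \<le> 1"
  by (simp_all add: transition_def)

lemma continuous_on_transition: "y < x \<Longrightarrow> \<epsilon> > 0 \<Longrightarrow> continuous_on S (transition \<epsilon> \<alpha> y x \<beta>)"
  unfolding transition_def by (intro continuous_intros) auto

lemma transition_low:
  assumes "\<epsilon> > 0" "y < x" "t \<le> \<alpha> \<or> x \<le> t" "t \<le> \<beta>"
  shows "transition \<epsilon> \<alpha> y x \<beta> t = -1"
proof -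
  have "(t - \<beta>) / \<epsilon> \<le> 0" using assms by (simp add: divide_nonpos_pos)
  moreover have "(t - \<alpha>) / \<epsilon> \<le> 0 \<or> 2 * (x - t) / (x - y) \<le> 0"
    using assms by (auto simp: divide_nonpos_pos)
  ultimately show ?thesis by (auto simp: transition_def)
qed

lemma transition_high:
  assumes "\<epsilon> > 0" "y < x" "\<alpha> + 2 * \<epsilon> \<le> t \<and> t \<le> y \<or> \<beta> + 2 * \<epsilon> \<le> t"
  shows "transition \<epsilon> \<alpha> y x \<beta> t = 1"
proof -
  have "(t - \<alpha>) / \<epsilon> \<ge> 2 \<and> 2 * (x - t) / (x - y) \<ge> 2 \<or> (t - \<beta>) / \<epsilon> \<ge> 2"
    using assms by (auto simp: pos_le_divide_eq)
  then show ?thesis by (auto simp: transition_def)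
qed

text \<open>Here \<open>p\<close> is the distance from a zero of the kernel and \<open>s\<close> the
  approximate sign. A wrong sign costs at most 2 m p, and it can occur only for p < 2
  \<epsilon>.\<close>

lemma ramp_loss:
  fixes m p s \<epsilon> :: real
  assumes "m \<ge> 0" "p \<ge> 0" "-1 \<le> s" "p \<ge> 2 * \<epsilon> \<Longrightarrow> s = 1" "\<epsilon> > 0"
  shows "-1 * (p * (m * s)) \<le> - m * p + 4 * m * \<epsilon>"
proof (cases "p \<ge> 2 * \<epsilon>")
  case True
  then show ?thesis using assms by simp
next
  case False
  have "m * p * (-1) \<le> m * p * s" using assms by (intro mult_left_mono) auto
  moreover have "m * p \<le> m * (2 * \<epsilon>)" using False assms by (intro mult_left_mono) auto
  ultimately show ?thesis by (simp add: algebra_simps)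
qed

theorem corollary4:
  fixes T :: "real set" and a b x :: real
  assumes "time_scale T"
    and "a \<in> T" and "b \<in> T" and "a < b"
    and "(5 * a + b) / 6 \<in> T" and "(a + 5 * b) / 6 \<in> T"
    and "x \<in> {(5 * a + b) / 6 .. (a + 5 * b) / 6} \<inter> T"
  shows
    "let S = T \<inter> {a..b};
         M = sup_delta_deriv S a b;
         E = (\<lambda>f. \<bar>delta_integral S a b (\<lambda>t. f (forward_jump S t))
                    - (b - a) / 3 * ((f a + f b) / 2 + 2 * f x)\<bar>);
         H = ts_monomial T 2 a ((5 * a + b) / 6) + ts_monomial T 2 x ((5 * a + b) / 6)
             + ts_monomial T 2 x ((a + 5 * b) / 6) + ts_monomial T 2 b ((a + 5 * b) / 6)
     in (\<forall>f. delta_differentiable S f \<longrightarrow> ereal (E f) \<le> M f * ereal H)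
        \<and> (\<forall>m\<ge>0. \<forall>r < m * H. \<exists>f. delta_differentiable S f \<and> M f = ereal m \<and> r < E f)"
proof -
  define S where "S = T \<inter> {a..b}"
  define \<alpha> where "\<alpha> = (5 * a + b) / 6"
  define \<beta> where "\<beta> = (a + 5 * b) / 6"
  define M where "M = sup_delta_deriv S a b"
  define E where "E f = \<bar>delta_integral S a b (\<lambda>t. f (forward_jump S t))
                    - (b - a) / 3 * ((f a + f b) / 2 + 2 * f x)\<bar>" for f
  define H where "H = ts_monomial T 2 a \<alpha> + ts_monomial T 2 x \<alpha>
             + ts_monomial T 2 x \<beta> + ts_monomial T 2 b \<beta>"
  have order: "a < \<alpha>" "\<alpha> \<le> x" "x \<le> \<beta>" "\<beta> < b" "\<alpha> < \<beta>"
    using assms by (auto simp: \<alpha>_def \<beta>_def)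
  have T: "closed T" "T \<noteq> {}" using assms(1) by (auto simp: time_scale_def)
  have inT: "a \<in> T" "\<alpha> \<in> T" "x \<in> T" "\<beta> \<in> T" "b \<in> T"
    using assms by (auto simp: \<alpha>_def \<beta>_def)
  have S: "closed S" "S \<noteq> {}" using T inT order by (auto simp: S_def intro: closed_Int)
  have inS: "a \<in> S" "\<alpha> \<in> S" "x \<in> S" "\<beta> \<in> S" "b \<in> S"
    using inT order by (auto simp: S_def)
  have S_ge: "a \<le> t" if "t \<in> S" for t using that by (simp add: S_def)
  \<comment> \<open>Taken over all of \<open>T\<close>, as h_2 is; its derivatives are restricted to
    \<open>S\<close> below.\<close>
  obtain G where G: "delta_antiderivative T (\<lambda>t. t) G"
    using delta_antiderivative_exists_continuous[OF T, of "\<lambda>t. t"] by auto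
  define V where "V s t = G t - s * t" for s t
  have V_cont: "continuous_on S (V s)" for s
    unfolding V_def
    by (intro continuous_intros continuous_on_subset[OF delta_antiderivative_continuous_on[OF G]])
      (simp add: S_def)
  have V_deriv: "has_delta_deriv S (V s) t (t - s)" if "t \<in> S" "t < b" for s t
  proof -
    have t: "t \<in> T" "a \<le> t" using that by (auto simp: S_def)
    have "has_delta_deriv S G t t"
      unfolding S_def using t that inT G
      by (intro has_delta_deriv_Int_atLeastAtMost has_delta_deriv_of_antiderivative[OF G, of t b]) auto
    from has_delta_deriv_diff[OF this has_delta_deriv_cmult[OF has_delta_deriv_id, where c = s]]
    show ?thesis by (simp add: V_def[abs_def])
  qed
  have h2: "ts_monomial T 2 t s = V s t - V s s" if "t \<in> T" "s \<in> T" for s t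
    using ts_monomial_2[OF T(1) that(2,1) G] by (simp add: V_def)
  have H: "H = (V \<alpha> a - V \<alpha> \<alpha>) + (V \<alpha> x - V \<alpha> \<alpha>) + (V \<beta> x - V \<beta> \<beta>) + (V \<beta> b - V \<beta> \<beta>)"
    using h2 inT by (simp add: H_def)

  \<comment> \<open>Strictness matters for infinite M, because \<infinity> * 0 = 0 in
    \<open>ereal\<close>.\<close>
  have H_pos: "H > 0"
  proof -
    have up: "V s c \<le> V s d" if "s \<le> c" "c \<in> S" "d \<in> S" "c \<le> d" "d \<le> b" for s c d
    proof (rule delta_mono[OF S(1) that(2-4) V_cont])
      fix t assume "t \<in> S" "c \<le> t" "t < d"
      then show "\<exists>D\<ge>0. has_delta_deriv S (V s) t D"
        using that by (intro exI[of _ "t - s"] conjI V_deriv) auto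
    qed
    have "V \<beta> \<beta> - V \<beta> x \<le> (\<lambda>_. 0) \<beta> - (\<lambda>_. 0 :: real) x"
    proof (rule delta_compare[OF S(1) inS(3,4) order(3) V_cont])
      fix t assume "t \<in> S" "t < \<beta>"
      then show "\<exists>D E. has_delta_deriv S (V \<beta>) t D \<and> has_delta_deriv S (\<lambda>_. 0) t E \<and> D \<le> E"
        using order by (intro exI[of _ "t - \<beta>"] exI[of _ 0] conjI V_deriv has_delta_deriv_const) auto
    qed (intro continuous_intros)
    \<comment> \<open>The square of t - \<alpha> has derivative (t - \<alpha>) + (\<sigma>(t) -
      \<alpha>), which is at least 2 (t - \<alpha>). Hence h_2(a,\<alpha>) is at least half the
      square of a - \<alpha>, and the other three terms are nonnegative.\<close>
    moreover have "(\<lambda>t. 2 * V \<alpha> t) \<alpha> - (\<lambda>t. 2 * V \<alpha> t) a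
        \<le> (\<lambda>t. (t - \<alpha>) * (t - \<alpha>)) \<alpha> - (\<lambda>t. (t - \<alpha>) * (t - \<alpha>)) a"
    proof (intro delta_compare[OF S(1)] inS)
      fix t assume t: "t \<in> S" "t < \<alpha>"
      have "has_delta_deriv S (\<lambda>t. t - \<alpha>) t 1"
        using has_delta_deriv_diff[OF has_delta_deriv_id has_delta_deriv_const] by fastforce
      from has_delta_deriv_linear_mult[OF this, of 1 \<alpha>]
      have "has_delta_deriv S (\<lambda>t. (t - \<alpha>) * (t - \<alpha>)) t ((t - \<alpha>) + (forward_jump S t - \<alpha>))"
        by simp
      moreover have "has_delta_deriv S (\<lambda>t. 2 * V \<alpha> t) t (2 * (t - \<alpha>))"
        using t order by (intro has_delta_deriv_cmult V_deriv) auto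
      moreover have "2 * (t - \<alpha>) \<le> (t - \<alpha>) + (forward_jump S t - \<alpha>)"
        using forward_jump_ge[of t S] by simp
      ultimately show "\<exists>D E. has_delta_deriv S (\<lambda>t. 2 * V \<alpha> t) t D \<and>
          has_delta_deriv S (\<lambda>t. (t - \<alpha>) * (t - \<alpha>)) t E \<and> D \<le> E"
        by blast
    qed (use order in \<open>auto intro!: continuous_intros V_cont\<close>)
    moreover have "(a - \<alpha>) * (a - \<alpha>) > 0" using order by (simp add: mult_neg_neg)
    ultimately show ?thesis
      using up[of \<alpha> \<alpha> x] up[of \<beta> \<beta> b] inS order unfolding H by simp
  qed

  \<comment> \<open>The Montgomery identity\<close>
  define X where "X f \<Phi> = (((x - \<alpha>) * f x - \<Phi> x) - ((a - \<alpha>) * f a - \<Phi> a))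
      + (((b - \<beta>) * f b - \<Phi> b) - ((x - \<beta>) * f x - \<Phi> x))" for f \<Phi> :: "real \<Rightarrow> real"
  have E_eq: "E f = \<bar>X f \<Phi>\<bar>"
    if "delta_antiderivative S (\<lambda>t. f (forward_jump S t)) \<Phi>" for f \<Phi>
  proof -
    have "delta_integral S a b (\<lambda>t. f (forward_jump S t)) = \<Phi> b - \<Phi> a"
      by (rule delta_integral_eq[OF S(1) inS(1,5) that])
    \<comment> \<open>The coefficients match because \<alpha> - a = b - \<beta> = (b - a)/6 and
      \<beta> - \<alpha> = 2 (b - a)/3.\<close>
    moreover have "\<Phi> b - \<Phi> a - (b - a) / 3 * ((f a + f b) / 2 + 2 * f x) = - X f \<Phi>"
      by (simp add: X_def \<alpha>_def \<beta>_def field_simps)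
    ultimately show ?thesis by (simp add: E_def)
  qed

  have compare: "q * (((d - s) * f d - \<Phi> d) - ((c - s) * f c - \<Phi> c)) \<le> K * (V s d - V s c) + L * (d - c)"
    if "delta_differentiable S f" "delta_antiderivative S (\<lambda>t. f (forward_jump S t)) \<Phi>"
      "c \<in> S" "d \<in> S" "c \<le> d"
      "\<And>t. t \<in> S \<Longrightarrow> c \<le> t \<Longrightarrow> t < d \<Longrightarrow> c < t \<or> c < forward_jump S c \<Longrightarrow>
         q * ((t - s) * delta_deriv S f t) \<le> K * (t - s) + L"
    for f \<Phi> c d s q K L
  proof (rule weighted_delta_compare[OF S(1) that(3-5) _ _ V_cont _ _ _ that(6)])
    show "continuous_on S f"
      using that(1) by (intro continuous_on_of_delta_deriv) (auto simp: delta_differentiable_def)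
    show "continuous_on S \<Phi>" by (rule delta_antiderivative_continuous_on[OF that(2)])
    fix t assume t: "t \<in> S" "t < d"
    have "\<exists>D. has_delta_deriv S f t D"
      using that(1) in_ts_kappa[OF t(1) that(4) t(2)] by (auto simp: delta_differentiable_def)
    then show "has_delta_deriv S f t (delta_deriv S f t)"
      using delta_deriv_eq t that(4) by metis
    show "has_delta_deriv S \<Phi> t (f (forward_jump S t))"
      by (rule has_delta_deriv_of_antiderivative[OF that(2) t(1) that(4) t(2)])
    have "d \<le> b" using that(4) by (simp add: S_def)
    then show "has_delta_deriv S (V s) t (t - s)" using t V_deriv by simp
  qed

  have \<Phi>_exists: "\<exists>\<Phi>. delta_antiderivative S (\<lambda>t. f (forward_jump S t)) \<Phi>"
    if "delta_differentiable S f" for f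
    using that by (intro delta_antiderivative_exists_forward_jump S continuous_on_of_delta_deriv)
      (auto simp: delta_differentiable_def)

  \<comment> \<open>The upper bound\<close>
  have upper: "ereal (E f) \<le> M f * ereal H" if f: "delta_differentiable S f" for f
  proof -
    obtain \<Phi> where \<Phi>: "delta_antiderivative S (\<lambda>t. f (forward_jump S t)) \<Phi>"
      using \<Phi>_exists[OF f] by blast
    let ?P = "(S \<inter> {a<..<b}) \<union> (if a < forward_jump S a then {a} else {})"
    have M_ge: "ereal \<bar>delta_deriv S f t\<bar> \<le> M f" if "t \<in> ?P" for t
      unfolding M_def sup_delta_deriv_def using that by (rule SUP_upper)
    \<comment> \<open>The supremum runs over a nonempty set, so it is nonnegative and not
      -\<infinity>.\<close>
    have "\<alpha> \<in> ?P" using inS order by auto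
    then have "0 \<le> M f" using M_ge[of \<alpha>] by (meson abs_ge_zero ereal_less_eq(5) order_trans)
    then consider (infinite) "M f = \<infinity>" | m where "M f = ereal m" "m \<ge> 0"
      by (cases "M f") auto
    then show ?thesis
    proof cases
      case infinite
      then show ?thesis using H_pos by simp
    next
      case 2
      have bound: "\<bar>delta_deriv S f t\<bar> \<le> m"
        if "t \<in> S" "c \<le> t" "t < d" "c < t \<or> c < forward_jump S c" "c \<in> S" "d \<in> S" for t c d
      proof -
        \<comment> \<open>If t = a then c = a, and the side condition makes \<open>a\<close>
          right-scattered, which is exactly when \<open>a\<close> enters the supremum.\<close>
        have "t \<in> ?P" using that by (cases "t = a") (auto simp: S_def)
        then show ?thesis using M_ge[of t] 2(1) by simp
      qed
      have weight: "q * ((t - s) * delta_deriv S f t) \<le> m * \<bar>t - s\<bar>"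
        if "\<bar>delta_deriv S f t\<bar> \<le> m" "q \<in> {-1, 1}" for q s t
      proof -
        have "q * ((t - s) * delta_deriv S f t) \<le> \<bar>(t - s) * delta_deriv S f t\<bar>"
          using that(2) by auto
        also have "\<dots> \<le> \<bar>t - s\<bar> * m"
          unfolding abs_mult using that(1) by (intro mult_left_mono) auto
        finally show ?thesis by (simp add: mult.commute)
      qed
      have left: "q * ((t - s) * delta_deriv S f t) \<le> - m * (t - s) + 0"
        if "\<bar>delta_deriv S f t\<bar> \<le> m" "t \<le> s" "q \<in> {-1, 1}" for q s t
        using weight[OF that(1,3), of s] that(2) by (simp add: algebra_simps)
      have right: "q * ((t - s) * delta_deriv S f t) \<le> m * (t - s) + 0"
        if "\<bar>delta_deriv S f t\<bar> \<le> m" "s \<le> t" "q \<in> {-1, 1}" for q s t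
        using weight[OF that(1,3), of s] that(2) by simp
      \<comment> \<open>The kernel is nonpositive on [a,\<alpha>] and before \<beta> on [x,\<beta>],
        nonnegative on [\<alpha>,x) and [\<beta>,b]; each piece contributes one term of
        \<open>H\<close>.\<close>
      have "q * X f \<Phi> \<le> m * H" if q: "q \<in> {-1, 1}" for q
      proof -
        have 1: "q * (((\<alpha> - \<alpha>) * f \<alpha> - \<Phi> \<alpha>) - ((a - \<alpha>) * f a - \<Phi> a))
            \<le> - m * (V \<alpha> \<alpha> - V \<alpha> a) + 0 * (\<alpha> - a)"
          using inS order q by (intro compare[OF f \<Phi>] left bound[of _ a \<alpha>]) auto
        have 2: "q * (((x - \<alpha>) * f x - \<Phi> x) - ((\<alpha> - \<alpha>) * f \<alpha> - \<Phi> \<alpha>))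
            \<le> m * (V \<alpha> x - V \<alpha> \<alpha>) + 0 * (x - \<alpha>)"
          using inS order q by (intro compare[OF f \<Phi>] right bound[of _ \<alpha> x]) auto
        have 3: "q * (((\<beta> - \<beta>) * f \<beta> - \<Phi> \<beta>) - ((x - \<beta>) * f x - \<Phi> x))
            \<le> - m * (V \<beta> \<beta> - V \<beta> x) + 0 * (\<beta> - x)"
          using inS order q by (intro compare[OF f \<Phi>] left bound[of _ x \<beta>]) auto
        have 4: "q * (((b - \<beta>) * f b - \<Phi> b) - ((\<beta> - \<beta>) * f \<beta> - \<Phi> \<beta>))
            \<le> m * (V \<beta> b - V \<beta> \<beta>) + 0 * (b - \<beta>)"
          using inS order q by (intro compare[OF f \<Phi>] right bound[of _ \<beta> b]) auto
        show ?thesis using 1 2 3 4 unfolding X_def H by (simp add: algebra_simps)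
      qed
      from this[of 1] this[of "-1"] have "\<bar>X f \<Phi>\<bar> \<le> m * H" by simp
      then show ?thesis using 2(1) E_eq[OF \<Phi>] by simp
    qed
  qed

  \<comment> \<open>Sharpness\<close>
  have sharp: "\<exists>f. delta_differentiable S f \<and> M f = ereal m \<and> r < E f" if m: "m \<ge> 0" "r < m * H" for m r
  proof -
    \<comment> \<open>The ramps after \<alpha> and \<beta> lose at most 4 m (b - a) \<epsilon>, the
      drop before \<open>x\<close> at most 2 m (b - a) \<epsilon>. The added 1 makes the total
      strictly less than m H - r and covers m = 0.\<close>
    define \<epsilon> where "\<epsilon> = (m * H - r) / (6 * m * (b - a) + 1)"
    have den: "6 * m * (b - a) + 1 > 0" using m order by (intro add_nonneg_pos) auto
    then have \<epsilon>: "\<epsilon> > 0" using m by (simp add: \<epsilon>_def)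
    have "6 * m * (b - a) * \<epsilon> + \<epsilon> = \<epsilon> * (6 * m * (b - a) + 1)" by (simp add: algebra_simps)
    also have "\<dots> = m * H - r" using den by (simp add: \<epsilon>_def)
    finally have loss: "6 * m * (b - a) * \<epsilon> < m * H - r" using \<epsilon> by simp
    obtain y where y: "y < x" "\<alpha> < x \<Longrightarrow> y \<in> S \<and> \<alpha> \<le> y \<and>
        ((\<forall>t\<in>S. y \<le> t \<longrightarrow> t < x \<longrightarrow> t = y) \<or> x - y < \<epsilon>)"
    proof (cases "\<alpha> < x")
      case True
      from left_neighbour[OF S(1) inS(2) this \<epsilon>] show thesis using that by metis
    next
      case False
      \<comment> \<open>For x = \<alpha> the kernel has no positive stretch before \<open>x\<close>,
        so any y < x will do.\<close>
      then show thesis using that[of "x - 1"] by simp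
    qed
    let ?s = "transition \<epsilon> \<alpha> y x \<beta>"
    have s_cont: "continuous_on S (\<lambda>t. m * ?s t)"
      using y \<epsilon> by (intro continuous_intros continuous_on_transition)
    obtain f where f: "delta_antiderivative S (\<lambda>t. m * ?s t) f"
      using delta_antiderivative_exists_continuous[OF S s_cont] by blast
    have diff: "delta_differentiable S f"
      using f by (auto simp: delta_antiderivative_def delta_differentiable_def)
    have f': "delta_deriv S f t = m * ?s t" if "t \<in> S" "t < d" "d \<in> S" for t d
      using that by (intro delta_deriv_eq[of _ _ _ _ d] has_delta_deriv_of_antiderivative[OF f, of _ d])
    note low = transition_low[OF \<epsilon> y(1)] and high = transition_high[OF \<epsilon> y(1)]
    have "M f = ereal m"
    proof (rule antisym)
      show "M f \<le> ereal m"
        unfolding M_def sup_delta_deriv_def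
      proof (rule SUP_least)
        fix t assume "t \<in> (S \<inter> {a<..<b}) \<union> (if a < forward_jump S a then {a} else {})"
        then have "delta_deriv S f t = m * ?s t"
          using inS \<open>a < b\<close> by (intro f'[of _ b]) (auto split: if_splits)
        moreover have "\<bar>?s t\<bar> \<le> 1" using transition_bounds[of \<epsilon> \<alpha> y x \<beta> t] by (simp add: abs_le_iff)
        ultimately show "ereal \<bar>delta_deriv S f t\<bar> \<le> ereal m"
          using m(1) mult_left_mono[of "\<bar>?s t\<bar>" 1 m] by (simp add: abs_mult)
      qed
      \<comment> \<open>The supremum is attained at the interior point \<open>x\<close>, where the
        slope is -m.\<close>
      have "\<bar>delta_deriv S f x\<bar> = m"
        using f'[of x b] low[of x \<alpha> \<beta>] inS order m by simp
      then show "ereal m \<le> M f"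
        unfolding M_def sup_delta_deriv_def using inS order by (intro SUP_upper2[of x]) auto
    qed
    moreover have "r < E f"
    proof -
      obtain \<Phi> where \<Phi>: "delta_antiderivative S (\<lambda>t. f (forward_jump S t)) \<Phi>"
        using \<Phi>_exists[OF diff] by blast
      let ?W = "\<lambda>s t. (t - s) * f t - \<Phi> t"
      \<comment> \<open>The factor -1 makes these lower bounds for \<open>X\<close>. On
        [a,\<alpha>), and likewise on [x,\<beta>), the slope is exactly -m and nothing is
        lost.\<close>
      have 1: "-1 * (?W \<alpha> \<alpha> - ?W \<alpha> a) \<le> m * (V \<alpha> \<alpha> - V \<alpha> a) + 0 * (\<alpha> - a)"
        using inS order f'[of _ \<alpha>] low by (intro compare[OF diff \<Phi>]) auto
      have ramp: "-1 * ((t - \<alpha>) * delta_deriv S f t) \<le> - m * (t - \<alpha>) + 4 * m * \<epsilon>"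
        if "t \<in> S" "\<alpha> \<le> t" "t \<le> y" for t
        using that y(1) f'[of t x] inS ramp_loss[OF m(1), of "t - \<alpha>" "?s t" \<epsilon>] \<epsilon>
          transition_bounds(1)[of \<epsilon> \<alpha> y x \<beta> t] high[of \<alpha> t \<beta>] by auto
      have 2: "-1 * (?W \<alpha> x - ?W \<alpha> \<alpha>)
          \<le> - m * (V \<alpha> x - V \<alpha> \<alpha>) + 4 * m * \<epsilon> * (x - \<alpha>) + 2 * m * (b - a) * \<epsilon>"
      proof (cases "\<alpha> < x")
        case False
        then show ?thesis using order m \<epsilon> by simp
      next
        case True
        note y2 = y(2)[OF True]
        show ?thesis
        proof (cases "\<forall>t\<in>S. y \<le> t \<longrightarrow> t < x \<longrightarrow> t = y")
          case True
          have "-1 * (?W \<alpha> x - ?W \<alpha> \<alpha>) \<le> - m * (V \<alpha> x - V \<alpha> \<alpha>) + 4 * m * \<epsilon> * (x - \<alpha>)"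
          proof (rule compare[OF diff \<Phi> inS(2,3) order(2)])
            fix t assume t: "t \<in> S" "\<alpha> \<le> t" "t < x"
            \<comment> \<open>The drop falls into a gap of \<open>S\<close>, so the ramp estimate is
              valid up to \<open>x\<close>.\<close>
            have "t \<le> y" using True t by (cases "y \<le> t") auto
            then show "-1 * ((t - \<alpha>) * delta_deriv S f t) \<le> - m * (t - \<alpha>) + 4 * m * \<epsilon>"
              by (rule ramp[OF t(1,2)])
          qed
          moreover have "2 * m * (b - a) * \<epsilon> \<ge> 0" using m \<epsilon> order by simp
          ultimately show ?thesis by linarith
        next
          case False
          have A: "-1 * (?W \<alpha> y - ?W \<alpha> \<alpha>) \<le> - m * (V \<alpha> y - V \<alpha> \<alpha>) + 4 * m * \<epsilon> * (y - \<alpha>)"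
            using inS y2 by (intro compare[OF diff \<Phi>] ramp) auto
          \<comment> \<open>While the slope drops, only the bound -m from below is used. This costs
            at most 2 m (b - a) per unit length, over a length less than \<epsilon>.\<close>
          have B: "-1 * (?W \<alpha> x - ?W \<alpha> y) \<le> - m * (V \<alpha> x - V \<alpha> y) + 2 * m * (b - a) * (x - y)"
          proof (rule compare[OF diff \<Phi>])
            fix t assume t: "t \<in> S" "y \<le> t" "t < x"
            then have p: "0 \<le> t - \<alpha>" "t - \<alpha> \<le> b - a" using y2 order by auto
            have "(m * (t - \<alpha>)) * (-1) \<le> (m * (t - \<alpha>)) * ?s t"
              using m p transition_bounds by (intro mult_left_mono) auto
            moreover have "m * (t - \<alpha>) \<le> m * (b - a)" using p m by (intro mult_left_mono) auto
            ultimately show "-1 * ((t - \<alpha>) * delta_deriv S f t) \<le> - m * (t - \<alpha>) + 2 * m * (b - a)"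
              using f'[of t x] t inS by (simp add: algebra_simps)
          qed (use inS y y2 in auto)
          have "2 * m * (b - a) * (x - y) \<le> 2 * m * (b - a) * \<epsilon>"
            using False y2 m order by (intro mult_left_mono) auto
          moreover have "4 * m * \<epsilon> * (y - \<alpha>) \<le> 4 * m * \<epsilon> * (x - \<alpha>)"
            using y(1) m \<epsilon> by (intro mult_left_mono) auto
          ultimately show ?thesis using A B by (simp add: algebra_simps)
        qed
      qed
      have 3: "-1 * (?W \<beta> \<beta> - ?W \<beta> x) \<le> m * (V \<beta> \<beta> - V \<beta> x) + 0 * (\<beta> - x)"
        using inS order f'[of _ \<beta>] low by (intro compare[OF diff \<Phi>]) auto
      have 4: "-1 * (?W \<beta> b - ?W \<beta> \<beta>) \<le> - m * (V \<beta> b - V \<beta> \<beta>) + 4 * m * \<epsilon> * (b - \<beta>)"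
      proof (rule compare[OF diff \<Phi>])
        fix t assume t: "t \<in> S" "\<beta> \<le> t" "t < b"
        then show "-1 * ((t - \<beta>) * delta_deriv S f t) \<le> - m * (t - \<beta>) + 4 * m * \<epsilon>"
          using f'[of t b] inS ramp_loss[OF m(1), of "t - \<beta>" "?s t" \<epsilon>] \<epsilon>
            transition_bounds(1)[of \<epsilon> \<alpha> y x \<beta> t] high[of \<alpha> t \<beta>] by auto
      qed (use inS order in auto)
      have "4 * m * \<epsilon> * ((x - \<alpha>) + (b - \<beta>)) \<le> 4 * m * \<epsilon> * (b - a)"
        using m \<epsilon> order by (intro mult_left_mono) auto
      then have "m * H - 6 * m * (b - a) * \<epsilon> \<le> X f \<Phi>"
        using 1 2 3 4 unfolding X_def H by (simp add: algebra_simps)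
      then show ?thesis using loss E_eq[OF \<Phi>] by linarith
    qed
    ultimately show ?thesis using diff by blast
  qed

  show ?thesis
    using upper sharp
    unfolding Let_def S_def[symmetric] \<alpha>_def[symmetric] \<beta>_def[symmetric] M_def[symmetric]
      E_def[symmetric] H_def[symmetric] by blast
qed

end
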